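(* Let $\mathcal T$ be an EMV-tribe of fuzzy sets of a set $\Omega\ne\emptyset$ such that $(f+1)/2\in\mathcal T$ for each $f\in\mathcal T$. Then $s(f)=(f+1)/2$, $f\in\mathcal T$, is a square root on $\mathcal T$. Moreover, $\mathcal T$ is in fact a tribe which is divisible and strict.
   Context: A system $\mathcal T\subseteq[0,1]^\Omega$ of fuzzy sets of a set $\Omega\neq\emptyset$ is an EMV-tribe if: (i) $0_\Omega\in\mathcal T$; (ii) if $a\in\mathcal T$ is a characteristic function, then (a) $f\in\mathcal T$ and $f\le a$ pointwise imply $a-f\in\mathcal T$, and (b) if $f_n\in\mathcal T$, $f_n\le a$ pointwise for all $n\ge1$, then $\bigoplus_nf_n\in\mathcal T$, where $(\bigoplus_nf_n)(\omega)=\min\{\sum_nf_n(\omega),a(\omega)\}$; (iii) for each $f,g\in\mathcal T$ there is a characteristic function $a\in\mathcal T$ with $f,g\le a$ pointwise; (iv) for each $\omega\in\Omega$ there is $f\in\mathcal T$ with $f(\omega)=1$. Every EMV-tribe is an EMV-algebra under pointwise operations $\vee,\wedge$, $f\oplus g=\min\{f+g,1\}$, $0_\Omega$; in particular, $f\odot g=(f+g-1)\vee 0$ pointwise, and its idempotents are the characteristic functions in $\mathcal T$. A square root on $\mathcal T$ is a map $s:\mathcal T\to\mathcal T$ with $s(f)\odot s(f)=f$ for all $f$, and such that $g\odot g\le f$ implies $g\le s(f)$. A tribe is a system $\mathcal F\subseteq[0,1]^\Omega$ with $0_\Omega\in\mathcal F$, closed under $f\mapsto 1-f$ and under countable truncated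 sums $\min\{\sum_{n=1}^\infty f_n,1\}$; it is an MV-algebra under pointwise operations, with $f'=1-f$. It is strict if it has a square root $s$ with $s(0)=s(0)'$, and divisible if for each $f$ and integer $n\ge1$ there is $g$ in it with $n.g=f$ and $((n-1).g)\odot g=0$, where $0.g=0$, $n.g=(n-1).g\oplus g$. *)

theory Defs
  imports "HOL-Library.FuncSet" "HOL-Library.Extended_Nonnegative_Real"
begin

text \<open>
  A fuzzy set of \<open>\<Omega>\<close> is an extensional function from \<open>\<Omega>\<close> to \<open>[0,1]\<close> (it takes the value
  \<^const>\<open>undefined\<close> outside \<open>\<Omega>\<close>), so that equality of functions is equality on \<open>\<Omega>\<close>.
\<close>

type_synonym 'a fuzzy = "'a \<Rightarrow> real"

definition fuzzy_sets :: "'a set \<Rightarrow> 'a fuzzy set" where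
  "fuzzy_sets \<Omega> = \<Omega> \<rightarrow>\<^sub>E {0..1}"

definition fuzzy_const :: "'a set \<Rightarrow> real \<Rightarrow> 'a fuzzy" where
  "fuzzy_const \<Omega> c = (\<lambda>\<omega>\<in>\<Omega>. c)"

definition fuzzy_le :: "'a set \<Rightarrow> 'a fuzzy \<Rightarrow> 'a fuzzy \<Rightarrow> bool" where
  "fuzzy_le \<Omega> f g \<longleftrightarrow> (\<forall>\<omega>\<in>\<Omega>. f \<omega> \<le> g \<omega>)"

definition fuzzy_diff :: "'a set \<Rightarrow> 'a fuzzy \<Rightarrow> 'a fuzzy \<Rightarrow> 'a fuzzy" where
  "fuzzy_diff \<Omega> a f = (\<lambda>\<omega>\<in>\<Omega>. a \<omega> - f \<omega>)"

definition fuzzy_compl :: "'a set \<Rightarrow> 'a fuzzy \<Rightarrow> 'a fuzzy" where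
  "fuzzy_compl \<Omega> f = fuzzy_diff \<Omega> (fuzzy_const \<Omega> 1) f"

definition fuzzy_oplus :: "'a set \<Rightarrow> 'a fuzzy \<Rightarrow> 'a fuzzy \<Rightarrow> 'a fuzzy" where
  "fuzzy_oplus \<Omega> f g = (\<lambda>\<omega>\<in>\<Omega>. min (f \<omega> + g \<omega>) 1)"

definition fuzzy_odot :: "'a set \<Rightarrow> 'a fuzzy \<Rightarrow> 'a fuzzy \<Rightarrow> 'a fuzzy" where
  "fuzzy_odot \<Omega> f g = (\<lambda>\<omega>\<in>\<Omega>. max (f \<omega> + g \<omega> - 1) 0)"

text \<open>
  The series is summed in \<^typ>\<open>ennreal\<close>, since it may diverge before being truncated by \<open>a\<close>.
  The sequences are indexed from 0 instead of 1.
\<close>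

definition fuzzy_trunc_sum :: "'a set \<Rightarrow> 'a fuzzy \<Rightarrow> (nat \<Rightarrow> 'a fuzzy) \<Rightarrow> 'a fuzzy" where
  "fuzzy_trunc_sum \<Omega> a f =
     (\<lambda>\<omega>\<in>\<Omega>. enn2real (min (\<Sum>n. ennreal (f n \<omega>)) (ennreal (a \<omega>))))"

definition characteristic :: "'a set \<Rightarrow> 'a fuzzy \<Rightarrow> bool" where
  "characteristic \<Omega> a \<longleftrightarrow> (\<exists>A\<subseteq>\<Omega>. a = (\<lambda>\<omega>\<in>\<Omega>. if \<omega> \<in> A then 1 else 0))"

definition emv_tribe :: "'a set \<Rightarrow> 'a fuzzy set \<Rightarrow> bool" where
  "emv_tribe \<Omega> T \<longleftrightarrow>
     T \<subseteq> fuzzy_sets \<Omega> \<and>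
     fuzzy_const \<Omega> 0 \<in> T \<and>
     (\<forall>a\<in>T. characteristic \<Omega> a \<longrightarrow>
        (\<forall>f\<in>T. fuzzy_le \<Omega> f a \<longrightarrow> fuzzy_diff \<Omega> a f \<in> T) \<and>
        (\<forall>f. (\<forall>n. f n \<in> T \<and> fuzzy_le \<Omega> (f n) a) \<longrightarrow> fuzzy_trunc_sum \<Omega> a f \<in> T)) \<and>
     (\<forall>f\<in>T. \<forall>g\<in>T. \<exists>a\<in>T. characteristic \<Omega> a \<and> fuzzy_le \<Omega> f a \<and> fuzzy_le \<Omega> g a) \<and>
     (\<forall>\<omega>\<in>\<Omega>. \<exists>f\<in>T. f \<omega> = 1)"

definition tribe :: "'a set \<Rightarrow> 'a fuzzy set \<Rightarrow> bool" where
  "tribe \<Omega> F \<longleftrightarrow>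
     F \<subseteq> fuzzy_sets \<Omega> \<and>
     fuzzy_const \<Omega> 0 \<in> F \<and>
     (\<forall>f\<in>F. fuzzy_compl \<Omega> f \<in> F) \<and>
     (\<forall>f. (\<forall>n. f n \<in> F) \<longrightarrow> fuzzy_trunc_sum \<Omega> (fuzzy_const \<Omega> 1) f \<in> F)"

definition square_root :: "'a set \<Rightarrow> 'a fuzzy set \<Rightarrow> ('a fuzzy \<Rightarrow> 'a fuzzy) \<Rightarrow> bool" where
  "square_root \<Omega> T s \<longleftrightarrow>
     s \<in> T \<rightarrow> T \<and>
     (\<forall>f\<in>T. fuzzy_odot \<Omega> (s f) (s f) = f) \<and>
     (\<forall>f\<in>T. \<forall>g\<in>T. fuzzy_le \<Omega> (fuzzy_odot \<Omega> g g) f \<longrightarrow> fuzzy_le \<Omega> g (s f))"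

definition strict_tribe :: "'a set \<Rightarrow> 'a fuzzy set \<Rightarrow> bool" where
  "strict_tribe \<Omega> F \<longleftrightarrow>
     tribe \<Omega> F \<and>
     (\<exists>s. square_root \<Omega> F s \<and> s (fuzzy_const \<Omega> 0) = fuzzy_compl \<Omega> (s (fuzzy_const \<Omega> 0)))"

primrec fuzzy_mult :: "'a set \<Rightarrow> nat \<Rightarrow> 'a fuzzy \<Rightarrow> 'a fuzzy" where
  "fuzzy_mult \<Omega> 0 g = fuzzy_const \<Omega> 0"
| "fuzzy_mult \<Omega> (Suc n) g = fuzzy_oplus \<Omega> (fuzzy_mult \<Omega> n g) g"

definition divisible_tribe :: "'a set \<Rightarrow> 'a fuzzy set \<Rightarrow> bool" where
  "divisible_tribe \<Omega> F \<longleftrightarrow>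
     tribe \<Omega> F \<and>
     (\<forall>f\<in>F. \<forall>n\<ge>1. \<exists>g\<in>F. fuzzy_mult \<Omega> n g = f \<and>
        fuzzy_odot \<Omega> (fuzzy_mult \<Omega> (n - 1) g) g = fuzzy_const \<Omega> 0)"

end

theory Submission
  imports Defs
begin

text \<open>
  Since \<open>0 \<in> T\<close>, also the constant \<open>1/2\<close> lies in \<open>T\<close>, and the only characteristic function
  above it is \<open>1\<close>; hence \<open>1 \<in> T\<close>, and the EMV-tribe axioms with \<open>a = 1\<close> are those of a tribe.
  In a tribe, halving is the conjugate of \<open>f \<mapsto> (f + 1) / 2\<close> under complementation, and binary
  expansions turn closure under halving into closure under multiplication by any \<open>c \<in> [0,1]\<close>;
  the case \<open>c = 1/n\<close> is divisibility.
\<close>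

lemma fuzzy_sets_bounds:
  assumes "f \<in> fuzzy_sets \<Omega>" "\<omega> \<in> \<Omega>"
  shows "0 \<le> f \<omega>" "f \<omega> \<le> 1"
  using PiE_mem[of f \<Omega> "\<lambda>_. {0..1}" \<omega>] assms by (auto simp: fuzzy_sets_def)

lemma fuzzy_sets_extensional: "f \<in> fuzzy_sets \<Omega> \<Longrightarrow> f \<in> extensional \<Omega>"
  by (auto simp: fuzzy_sets_def PiE_def)

text \<open>The only positive value of a characteristic function is 1.\<close>

lemma characteristic_above_positive:
  assumes "characteristic \<Omega> a" "\<And>\<omega>. \<omega> \<in> \<Omega> \<Longrightarrow> 0 < a \<omega>"
  shows "a = fuzzy_const \<Omega> 1"
proof -
  obtain A where A: "a = (\<lambda>\<omega>\<in>\<Omega>. if \<omega> \<in> A then 1 else 0)"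
    using assms(1) by (auto simp: characteristic_def)
  have "\<omega> \<in> A" if "\<omega> \<in> \<Omega>" for \<omega>
    using assms(2)[OF that] that by (simp add: A split: if_splits)
  then show ?thesis
    by (auto simp: A fuzzy_const_def intro!: restrict_ext)
qed

text \<open>For \<open>a\<close> the constant 1, the side conditions
  \<open>fuzzy_le \<Omega> f a\<close> hold throughout \<open>T\<close>.\<close>

lemma emv_tribe_with_unit_imp_tribe:
  assumes T: "emv_tribe \<Omega> T" and one: "fuzzy_const \<Omega> 1 \<in> T"
  shows "tribe \<Omega> T"
proof -
  have sub: "T \<subseteq> fuzzy_sets \<Omega>"
    using T by (simp add: emv_tribe_def)
  have "characteristic \<Omega> (fuzzy_const \<Omega> 1)"
    by (auto simp: characteristic_def fuzzy_const_def intro!: exI[of _ \<Omega>] restrict_ext)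
  moreover have "fuzzy_le \<Omega> f (fuzzy_const \<Omega> 1)" if "f \<in> T" for f
    using fuzzy_sets_bounds(2)[of f \<Omega>] subsetD[OF sub that] by (simp add: fuzzy_le_def fuzzy_const_def)
  ultimately show ?thesis
    using T one by (simp add: emv_tribe_def tribe_def fuzzy_compl_def)
qed

text \<open>Doubling the midpoint and subtracting 1 returns f, and f \<ge> 0 keeps the truncation at
  0 inactive. For maximality, max (2g - 1) 0 \<le> f gives 2g - 1 \<le> f, that is, g \<le> (f +
  1)/2.\<close>

lemma midpoint_square_root:
  assumes sub: "T \<subseteq> fuzzy_sets \<Omega>"
    and mid: "\<And>f. f \<in> T \<Longrightarrow> (\<lambda>\<omega>\<in>\<Omega>. (f \<omega> + 1) / 2) \<in> T"
  shows "square_root \<Omega> T (\<lambda>f. \<lambda>\<omega>\<in>\<Omega>. (f \<omega> + 1) / 2)"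
  unfolding square_root_def
proof (intro conjI ballI impI)
  show "(\<lambda>f. \<lambda>\<omega>\<in>\<Omega>. (f \<omega> + 1) / 2) \<in> T \<rightarrow> T"
    using mid by auto
next
  fix f assume "f \<in> T"
  then have f: "f \<in> fuzzy_sets \<Omega>" using sub by auto
  show "fuzzy_odot \<Omega> (\<lambda>\<omega>\<in>\<Omega>. (f \<omega> + 1) / 2) (\<lambda>\<omega>\<in>\<Omega>. (f \<omega> + 1) / 2) = f"
  proof (rule extensionalityI[OF _ fuzzy_sets_extensional[OF f]])
    fix \<omega> assume "\<omega> \<in> \<Omega>"
    then show "fuzzy_odot \<Omega> (\<lambda>\<omega>\<in>\<Omega>. (f \<omega> + 1) / 2) (\<lambda>\<omega>\<in>\<Omega>. (f \<omega> + 1) / 2) \<omega> = f \<omega>"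
      using fuzzy_sets_bounds[OF f] by (simp add: fuzzy_odot_def field_simps)
  qed (simp add: fuzzy_odot_def)
next
  fix f g assume "fuzzy_le \<Omega> (fuzzy_odot \<Omega> g g) f"
  then show "fuzzy_le \<Omega> g (\<lambda>\<omega>\<in>\<Omega>. (f \<omega> + 1) / 2)"
    by (auto simp: fuzzy_le_def fuzzy_odot_def)
qed

text \<open>Passage from the \<open>ennreal\<close> series to a convergent real one: a sum of at
  most 1 is not truncated.\<close>

lemma fuzzy_trunc_sum_sums:
  assumes "\<omega> \<in> \<Omega>" "\<And>n. 0 \<le> f n \<omega>" "(\<lambda>n. f n \<omega>) sums x" "x \<le> 1"
  shows "fuzzy_trunc_sum \<Omega> (fuzzy_const \<Omega> 1) f \<omega> = x"
proof -
  have x: "summable (\<lambda>n. f n \<omega>)" "(\<Sum>n. f n \<omega>) = x"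
    using assms(3) by (auto simp: sums_iff)
  have "0 \<le> x"
    using suminf_nonneg[OF x(1)] assms(2) x(2) by simp
  have "(\<Sum>n. ennreal (f n \<omega>)) = ennreal x"
    using suminf_ennreal2[OF assms(2) x(1)] x(2) by simp
  moreover have "min (ennreal x) (ennreal 1) = ennreal x"
    using assms(4) by (intro min.absorb1 ennreal_leI)
  ultimately show ?thesis
    using assms(1) \<open>0 \<le> x\<close> by (simp add: fuzzy_trunc_sum_def fuzzy_const_def)
qed

text \<open>Digits after the binary point, indexed from 0, so digit \<open>n\<close> has weight
  1/2^(n+1). The difference of floors makes the expansion telescope.\<close>

definition binary_digit :: "real \<Rightarrow> nat \<Rightarrow> int" where
  "binary_digit c n = \<lfloor>2 ^ Suc n * c\<rfloor> - 2 * \<lfloor>2 ^ n * c\<rfloor>"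

lemma binary_digit_cases: "binary_digit c n = 0 \<or> binary_digit c n = 1"
  \<comment> \<open>With x = 2^n * c this is floor(2x) - 2 floor(x), which is 0 or 1.\<close>
  unfolding binary_digit_def power_Suc mult.assoc by linarith

lemma binary_expansion_sums:
  fixes c :: real
  assumes "0 \<le> c" "c < 1"
  shows "(\<lambda>n. of_int (binary_digit c n) / 2 ^ Suc n) sums c"
proof -
  \<comment> \<open>\<open>F n\<close> is c cut off after n binary digits; it lies between c -
    2^(-n) and c, and its increments are the terms of the series.\<close>
  define F where "F n = of_int \<lfloor>2 ^ n * c\<rfloor> / (2 ^ n :: real)" for n
  have "F \<longlonglongrightarrow> c"
  proof (rule tendsto_sandwich)
    have "c - (1/2) ^ n \<le> F n" for n
    proof -
      have "2 ^ n * c - 1 \<le> of_int \<lfloor>2 ^ n * c\<rfloor>" by linarith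
      then have "(2 ^ n * c - 1) / 2 ^ n \<le> F n"
        unfolding F_def by (rule divide_right_mono) simp
      then show ?thesis by (simp add: diff_divide_distrib power_divide)
    qed
    then show "\<forall>\<^sub>F n in sequentially. c - (1/2) ^ n \<le> F n" by simp
    have "F n \<le> c" for n
      by (simp add: F_def field_simps)
    then show "\<forall>\<^sub>F n in sequentially. F n \<le> c" by simp
    have "(\<lambda>n. c - (1/2) ^ n) \<longlonglongrightarrow> c - 0"
      by (intro tendsto_intros LIMSEQ_power_zero) simp
    then show "(\<lambda>n. c - (1/2) ^ n) \<longlonglongrightarrow> c" by simp
  qed simp
  then have "(\<lambda>n. F (Suc n) - F n) sums (c - F 0)"
    by (rule telescope_sums)
  \<comment> \<open>Here c < 1 matters: for c = 1 all digits vanish and \<open>F 0\<close> is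
    1.\<close>
  moreover have "F 0 = 0"
    using assms by (simp add: F_def floor_eq_iff)
  moreover have "F (Suc n) - F n = of_int (binary_digit c n) / 2 ^ Suc n" for n
    by (simp add: F_def binary_digit_def field_simps)
  ultimately show ?thesis by simp
qed

text \<open>The identity behind it is 1 - ((1 - f) + 1)/2 = f/2.\<close>

lemma tribe_half:
  assumes F: "tribe \<Omega> F"
    and mid: "\<And>f. f \<in> F \<Longrightarrow> (\<lambda>\<omega>\<in>\<Omega>. (f \<omega> + 1) / 2) \<in> F"
    and f: "f \<in> F"
  shows "(\<lambda>\<omega>\<in>\<Omega>. f \<omega> / 2) \<in> F"
proof -
  have compl: "fuzzy_compl \<Omega> g \<in> F" if "g \<in> F" for g
    using F that by (simp add: tribe_def)
  have "fuzzy_compl \<Omega> (\<lambda>\<omega>\<in>\<Omega>. (fuzzy_compl \<Omega> f \<omega> + 1) / 2) = (\<lambda>\<omega>\<in>\<Omega>. f \<omega> / 2)"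
    by (auto simp: fuzzy_compl_def fuzzy_diff_def fuzzy_const_def field_simps intro!: restrict_ext)
  then show ?thesis
    using compl[OF mid[OF compl[OF f]]] by simp
qed

lemma tribe_scale:
  fixes c :: real
  assumes F: "tribe \<Omega> F"
    and mid: "\<And>f. f \<in> F \<Longrightarrow> (\<lambda>\<omega>\<in>\<Omega>. (f \<omega> + 1) / 2) \<in> F"
    and f: "f \<in> F" and c: "0 \<le> c" "c \<le> 1"
  shows "(\<lambda>\<omega>\<in>\<Omega>. c * f \<omega>) \<in> F"
proof -
  have fs: "f \<in> fuzzy_sets \<Omega>"
    using F f by (auto simp: tribe_def)
  have restrict_f: "restrict f \<Omega> = f"
    using fuzzy_sets_extensional[OF fs] by (rule extensional_restrict)
  show ?thesis
  \<comment> \<open>The binary expansion used below represents only c < 1.\<close>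
  proof (cases "c = 1")
    case True
    then show ?thesis using f restrict_f by simp
  next
    case False
    then have "c < 1" using c by simp
    \<comment> \<open>Each term is 0 or f/2^(n+1), hence in \<open>F\<close>; the terms add up to c
      f \<le> 1, so the truncated sum is exactly c f.\<close>
    define g where "g n = (\<lambda>\<omega>\<in>\<Omega>. of_int (binary_digit c n) / 2 ^ Suc n * f \<omega>)" for n
    have dyadic: "(\<lambda>\<omega>\<in>\<Omega>. f \<omega> / 2 ^ n) \<in> F" for n
    proof (induction n)
      case 0
      then show ?case using f restrict_f by simp
    next
      case (Suc n)
      have "(\<lambda>\<omega>\<in>\<Omega>. (\<lambda>\<omega>\<in>\<Omega>. f \<omega> / 2 ^ n) \<omega> / 2) = (\<lambda>\<omega>\<in>\<Omega>. f \<omega> / 2 ^ Suc n)"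
        by (auto intro!: restrict_ext)
      then show ?case
        using tribe_half[OF F mid Suc.IH] by (simp only:)
    qed
    have "g n \<in> F" for n
      using binary_digit_cases[of c n]
    proof
      assume "binary_digit c n = 0"
      then have "g n = fuzzy_const \<Omega> 0"
        by (simp add: g_def fuzzy_const_def)
      then show ?thesis using F by (simp add: tribe_def)
    next
      assume "binary_digit c n = 1"
      then show ?thesis using dyadic[of "Suc n"] by (simp add: g_def)
    qed
    then have "fuzzy_trunc_sum \<Omega> (fuzzy_const \<Omega> 1) g \<in> F"
      using F by (simp add: tribe_def)
    moreover have "fuzzy_trunc_sum \<Omega> (fuzzy_const \<Omega> 1) g = (\<lambda>\<omega>\<in>\<Omega>. c * f \<omega>)"
    proof (rule extensionalityI[where A = \<Omega>])
      fix \<omega> assume \<omega>: "\<omega> \<in> \<Omega>"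
      note b = fuzzy_sets_bounds[OF fs \<omega>]
      have "fuzzy_trunc_sum \<Omega> (fuzzy_const \<Omega> 1) g \<omega> = c * f \<omega>"
      proof (rule fuzzy_trunc_sum_sums[OF \<omega>])
        show "0 \<le> g n \<omega>" for n
          using binary_digit_cases[of c n] b \<omega> by (auto simp: g_def)
        show "(\<lambda>n. g n \<omega>) sums (c * f \<omega>)"
          using sums_mult2[OF binary_expansion_sums[OF c(1) \<open>c < 1\<close>], of "f \<omega>"] \<omega>
          by (simp add: g_def)
        show "c * f \<omega> \<le> 1"
          using mult_le_one c b by blast
      qed
      then show "fuzzy_trunc_sum \<Omega> (fuzzy_const \<Omega> 1) g \<omega> = (\<lambda>\<omega>\<in>\<Omega>. c * f \<omega>) \<omega>"
        using \<omega> by simp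
    qed (simp_all add: fuzzy_trunc_sum_def)
    ultimately show ?thesis by simp
  qed
qed

text \<open>Truncating after every addition agrees with truncating once at the end: as g \<ge> 0, a
  partial sum that has reached 1 stays at least 1.\<close>

lemma fuzzy_mult_apply:
  assumes "\<omega> \<in> \<Omega>" "0 \<le> g \<omega>"
  shows "fuzzy_mult \<Omega> n g \<omega> = min (real n * g \<omega>) 1"
  using assms by (induction n) (auto simp: fuzzy_const_def fuzzy_oplus_def algebra_simps)

lemma fuzzy_mult_extensional: "fuzzy_mult \<Omega> n g \<in> extensional \<Omega>"
  by (cases n) (simp_all add: fuzzy_const_def fuzzy_oplus_def)

lemma midpoint_closed_divisible_tribe:
  assumes F: "tribe \<Omega> F"
    and mid: "\<And>f. f \<in> F \<Longrightarrow> (\<lambda>\<omega>\<in>\<Omega>. (f \<omega> + 1) / 2) \<in> F"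
  shows "divisible_tribe \<Omega> F"
  unfolding divisible_tribe_def
proof (intro conjI ballI allI impI F)
  fix f :: "'a \<Rightarrow> real" and n :: nat
  assume f: "f \<in> F" and n: "1 \<le> n"
  have fs: "f \<in> fuzzy_sets \<Omega>"
    using F f by (auto simp: tribe_def)
  \<comment> \<open>The witness is f/n; its n-fold sum is f, which is at most 1 and so survives
    truncation.\<close>
  define g where "g = (\<lambda>\<omega>\<in>\<Omega>. 1 / real n * f \<omega>)"
  have "g \<in> F"
    unfolding g_def using n by (intro tribe_scale[OF F mid f]) auto
  moreover have mult: "fuzzy_mult \<Omega> k g \<omega> = min (real k / real n * f \<omega>) 1"
    if "\<omega> \<in> \<Omega>" for k \<omega>
    using fuzzy_mult_apply[of \<omega> \<Omega> g k] fuzzy_sets_bounds[OF fs that] that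
    by (simp add: g_def)
  moreover have "fuzzy_mult \<Omega> n g = f"
    using mult n fuzzy_sets_bounds[OF fs]
    by (intro extensionalityI[OF fuzzy_mult_extensional fuzzy_sets_extensional[OF fs]]) simp
  moreover have "fuzzy_odot \<Omega> (fuzzy_mult \<Omega> (n - 1) g) g = fuzzy_const \<Omega> 0"
    unfolding fuzzy_odot_def fuzzy_const_def
  proof (rule restrict_ext)
    fix \<omega> assume \<omega>: "\<omega> \<in> \<Omega>"
    \<comment> \<open>Dropping the truncation only increases the left summand, and n \<ge> 1 makes
      the natural-number subtraction genuine.\<close>
    have "fuzzy_mult \<Omega> (n - 1) g \<omega> + g \<omega> \<le> real (n - 1) / real n * f \<omega> + 1 / real n * f \<omega>"
      using mult[OF \<omega>] \<omega> by (simp add: g_def)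
    also have "\<dots> = f \<omega>"
      using n by (simp add: of_nat_diff field_simps)
    also have "\<dots> \<le> 1"
      using fuzzy_sets_bounds[OF fs \<omega>] by simp
    finally show "max (fuzzy_mult \<Omega> (n - 1) g \<omega> + g \<omega> - 1) 0 = 0" by simp
  qed
  ultimately show "\<exists>g\<in>F. fuzzy_mult \<Omega> n g = f \<and>
      fuzzy_odot \<Omega> (fuzzy_mult \<Omega> (n - 1) g) g = fuzzy_const \<Omega> 0"
    by blast
qed

theorem proposition5p12:
  fixes \<Omega> :: "'a set" and T :: "('a \<Rightarrow> real) set"
  assumes "\<Omega> \<noteq> {}"
    and "emv_tribe \<Omega> T"
    and "\<And>f. f \<in> T \<Longrightarrow> (\<lambda>\<omega>\<in>\<Omega>. (f \<omega> + 1) / 2) \<in> T"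
  shows "square_root \<Omega> T (\<lambda>f. \<lambda>\<omega>\<in>\<Omega>. (f \<omega> + 1) / 2) \<and>
         tribe \<Omega> T \<and> divisible_tribe \<Omega> T \<and> strict_tribe \<Omega> T"
proof -
  let ?s = "\<lambda>f :: 'a \<Rightarrow> real. \<lambda>\<omega>\<in>\<Omega>. (f \<omega> + 1) / 2"
  have sub: "T \<subseteq> fuzzy_sets \<Omega>" and zero: "fuzzy_const \<Omega> 0 \<in> T"
    using assms(2) by (auto simp: emv_tribe_def)
  have half: "?s (fuzzy_const \<Omega> 0) \<in> T"
    using assms(3)[OF zero] .
  \<comment> \<open>Axiom (iii) is applied to the constant 1/2 paired with itself.\<close>
  then obtain a where a: "a \<in> T" "characteristic \<Omega> a" "fuzzy_le \<Omega> (?s (fuzzy_const \<Omega> 0)) a"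
    using assms(2) unfolding emv_tribe_def by meson
  have "0 < a \<omega>" if "\<omega> \<in> \<Omega>" for \<omega>
    using a(3) that by (force simp: fuzzy_le_def fuzzy_const_def)
  then have one: "fuzzy_const \<Omega> 1 \<in> T"
    using characteristic_above_positive[OF a(2)] a(1) by simp
  have tribe: "tribe \<Omega> T"
    using emv_tribe_with_unit_imp_tribe[OF assms(2) one] .
  have sqrt: "square_root \<Omega> T ?s"
    using midpoint_square_root[OF sub assms(3)] .
  \<comment> \<open>Strictness: the square root of 0 is the constant 1/2, its own
    complement.\<close>
  have "?s (fuzzy_const \<Omega> 0) = fuzzy_compl \<Omega> (?s (fuzzy_const \<Omega> 0))"
    by (auto simp: fuzzy_compl_def fuzzy_diff_def fuzzy_const_def intro!: restrict_ext)
  then have "strict_tribe \<Omega> T"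
    unfolding strict_tribe_def using tribe sqrt by blast
  then show ?thesis
    using sqrt tribe midpoint_closed_divisible_tribe[OF tribe assms(3)] by blast
qed

end
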